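(* Let $\mathcal{C}$ be a Krull-Schmidt category with local descending chain condition on ideals. Let $\mathfrak{I}$ be an idempotent ideal of $\mathcal{C}$ and let $f \in \mathfrak{I}$. Then there are $f_1, f_2 \in \mathfrak{I}$ such that $f = f_1 + f_2$, the morphism $f_1$ is generated by identity morphisms from $\mathfrak{I}$ (that is, $f_1$ belongs to the ideal of $\mathcal{C}$ generated by the identity morphisms contained in $\mathfrak{I}$), and $f_2 \in \mathrm{rad}_{\mathcal{C}}^*$.
   Context: An additive category $\mathcal{C}$ is a Krull-Schmidt category if it is skeletally small, every indecomposable object has a local endomorphism ring, and every object is a finite coproduct of indecomposable objects. An ideal $\mathfrak{I}$ of a skeletally small additive category $\mathcal{C}$ is a class of morphisms containing all zero morphisms and closed under addition and under composition with arbitrary morphisms of $\mathcal{C}$ from the left and right, whenever defined; $\mathfrak{I}(X,Y) = \mathfrak{I}\cap \mathrm{Hom}_{\mathcal{C}}(X,Y)$. For a natural number $n\ge 1$, $\mathfrak{I}^n$ is the ideal generated by all compositions of $n$-tuples of morphisms from $\mathfrak{I}$. $\mathfrak{I}$ is idempotent if $\mathfrak{I}=\mathfrak{I}^2$. $\mathcal{C}$ has local descending chain condition on ideals if for any decreasing sequence $\mathfrak{I}_0 \supseteq \mathfrak{I}_1 \supseteq \mathfrak{I}_2\supseteq\dots$ of ideals of $\mathcal{C}$ and any objects $X,Y$ of $\mathcal{C}$ the chain $\mathfrak{I}_0(X,Y)\supseteq \mathfrak{I}_1(X,Y)\supseteq \mathfrak{I}_2(X,Y)\supseteq\dots$ stabilizes.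 Transfinite powers of an ideal $\mathfrak{I}$: $\mathfrak{I}^0$ is the ideal of all morphisms; for finite $n \geq 1$, $\mathfrak{I}^n$ is the ideal generated by all compositions of $n$-tuples of morphisms from $\mathfrak{I}$; if $\alpha$ is a limit ordinal, $\mathfrak{I}^\alpha=\bigcap_{\beta<\alpha}\mathfrak{I}^\beta$; if $\alpha$ is infinite and non-limit, write uniquely $\alpha=\beta+n$ with $\beta$ a limit ordinal and $n\ge1$ a natural number, and set $\mathfrak{I}^\alpha=(\mathfrak{I}^\beta)^{n+1}$. Put $\mathfrak{I}^*=\bigcap_\alpha \mathfrak{I}^\alpha$. The radical $\mathrm{rad}_{\mathcal{C}}$ of a Krull-Schmidt category is the ideal generated by all non-invertible morphisms between indecomposable objects; $\mathrm{rad}_{\mathcal{C}}^*$ is called the transfinite radical of $\mathcal{C}$. *)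

theory Defs
  imports "HOL-Algebra.Ring"
begin

text \<open>
  The type \<open>'a ordinal\<close> consists of the order types of all well-orders whose field is a set of
  elements of \<open>'a\<close>, i.e. of all ordinals of cardinality at most the cardinality of \<open>'a\<close>.
\<close>

quotient_type 'a ordinal = "'a rel" / partial: "\<lambda>r s. (r, s) \<in> (ordIso :: ('a rel \<times> 'a rel) set)"
proof (rule part_equivpI)
  show "\<exists>r :: 'a rel. (r, r) \<in> ordIso"
    using card_of_Well_order ordIso_reflexive by blast
  show "symp (\<lambda>r s. (r, s) \<in> (ordIso :: ('a rel \<times> 'a rel) set))"
    by (auto intro: sympI ordIso_symmetric)
  show "transp (\<lambda>r s. (r, s) \<in> (ordIso :: ('a rel \<times> 'a rel) set))"
    by (auto intro: transpI ordIso_transitive)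
qed

instantiation ordinal :: (type) wellorder
begin

lift_definition less_eq_ordinal :: "'a ordinal \<Rightarrow> 'a ordinal \<Rightarrow> bool"
  is "\<lambda>r s. (r, s) \<in> ordLeq"
  by (meson ordIso_ordLeq_trans ordIso_symmetric ordLeq_ordIso_trans)

lift_definition less_ordinal :: "'a ordinal \<Rightarrow> 'a ordinal \<Rightarrow> bool"
  is "\<lambda>r s. (r, s) \<in> ordLess"
  by (meson ordIso_ordLess_trans ordIso_symmetric ordLess_ordIso_trans)

instance
proof
  fix x y z :: "'a ordinal"
  show "(x < y) = (x \<le> y \<and> \<not> y \<le> x)"
  proof transfer
    fix r s :: "'a rel" assume "(r, r) \<in> ordIso" "(s, s) \<in> ordIso"
    then have "Well_order r" "Well_order s"
      by (auto simp: ordIso_def)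
    then show "((r, s) \<in> ordLess) = ((r, s) \<in> ordLeq \<and> (s, r) \<notin> ordLeq)"
      by (meson not_ordLess_ordLeq ordLess_imp_ordLeq ordLess_or_ordLeq)
  qed
  show "x \<le> x"
    by transfer (rule ordIso_imp_ordLeq)
  show "x \<le> y \<Longrightarrow> y \<le> z \<Longrightarrow> x \<le> z"
    by transfer (rule ordLeq_transitive)
  show "x \<le> y \<Longrightarrow> y \<le> x \<Longrightarrow> x = y"
    by transfer (simp add: ordIso_iff_ordLeq)
  show "x \<le> y \<or> y \<le> x"
  proof transfer
    fix r s :: "'a rel" assume "(r, r) \<in> ordIso" "(s, s) \<in> ordIso"
    then have "Well_order r" "Well_order s"
      by (auto simp: ordIso_def)
    then show "(r, s) \<in> ordLeq \<or> (s, r) \<in> ordLeq"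
      by (meson ordLess_imp_ordLeq ordLess_or_ordLeq)
  qed
next
  fix P :: "'a ordinal \<Rightarrow> bool" and a :: "'a ordinal"
  assume step: "\<And>x. (\<And>y. y < x \<Longrightarrow> P y) \<Longrightarrow> P x"
  have "\<forall>a. (r, r) \<in> ordIso \<longrightarrow> a = abs_ordinal r \<longrightarrow> P a" for r :: "'a rel"
  proof (induction r rule: wf_induct_rule[OF wf_ordLess])
    case (1 r)
    show ?case
    proof (intro allI impI)
      fix a assume r: "(r, r) \<in> ordIso" and a: "a = abs_ordinal r"
      show "P a"
      proof (rule step)
        fix y assume "y < a"
        obtain s where s: "(s, s) \<in> ordIso" "y = abs_ordinal s"
          using Quotient_ordinal unfolding Quotient_def by metis
        then have "(s, r) \<in> ordLess"
          using \<open>y < a\<close> a r by (simp add: less_ordinal.abs_eq)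
        then show "P y"
          using 1 s by blast
      qed
    qed
  qed
  then show "P a"
    using Quotient_ordinal unfolding Quotient_def by metis
qed

end


record ('o, 'm) preadd_cat =
  Obj :: "'o set"
  Mor :: "'m set"
  Dom :: "'m \<Rightarrow> 'o"
  Cod :: "'m \<Rightarrow> 'o"
  Ident :: "'o \<Rightarrow> 'm"
  Comp :: "'m \<Rightarrow> 'm \<Rightarrow> 'm"  (infixl "\<cdot>\<index>" 70)
  Plus :: "'m \<Rightarrow> 'm \<Rightarrow> 'm"  (infixl "\<boxplus>\<index>" 65)
  Zero :: "'o \<Rightarrow> 'o \<Rightarrow> 'm"

text \<open>
  \<open>g \<cdot>\<^bsub>C\<^esub> f\<close> is \<open>f\<close> followed by \<open>g\<close>. The operations are only
  meaningful on composable, respectively parallel, morphisms of the category.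
\<close>

definition Hom :: "('o, 'm, 'e) preadd_cat_scheme \<Rightarrow> 'o \<Rightarrow> 'o \<Rightarrow> 'm set" where
  "Hom C X Y = {f \<in> Mor C. Dom C f = X \<and> Cod C f = Y}"

definition hom_group :: "('o, 'm, 'e) preadd_cat_scheme \<Rightarrow> 'o \<Rightarrow> 'o \<Rightarrow> 'm monoid" where
  "hom_group C X Y = \<lparr>carrier = Hom C X Y, mult = Plus C, one = Zero C X Y\<rparr>"

definition End_ring :: "('o, 'm, 'e) preadd_cat_scheme \<Rightarrow> 'o \<Rightarrow> 'm ring" where
  "End_ring C X = \<lparr>carrier = Hom C X X, mult = Comp C, one = Ident C X,
     zero = Zero C X X, add = Plus C\<rparr>"

text \<open>The objects form a set, so skeletal smallness is automatic.\<close>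

locale preadditive_category =
  fixes C :: "('o, 'm, 'e) preadd_cat_scheme" (structure)
  assumes Dom_in_Obj: "f \<in> Mor C \<Longrightarrow> Dom C f \<in> Obj C"
    and Cod_in_Obj: "f \<in> Mor C \<Longrightarrow> Cod C f \<in> Obj C"
    and Ident_in_Hom: "X \<in> Obj C \<Longrightarrow> Ident C X \<in> Hom C X X"
    and Comp_in_Hom: "f \<in> Hom C X Y \<Longrightarrow> g \<in> Hom C Y Z \<Longrightarrow> g \<cdot> f \<in> Hom C X Z"
    and Comp_Ident: "f \<in> Hom C X Y \<Longrightarrow> f \<cdot> Ident C X = f"
    and Ident_Comp: "f \<in> Hom C X Y \<Longrightarrow> Ident C Y \<cdot> f = f"
    and Comp_assoc: "f \<in> Hom C W X \<Longrightarrow> g \<in> Hom C X Y \<Longrightarrow> h \<in> Hom C Y Z \<Longrightarrow>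
          (h \<cdot> g) \<cdot> f = h \<cdot> (g \<cdot> f)"
    and comm_group_Hom: "X \<in> Obj C \<Longrightarrow> Y \<in> Obj C \<Longrightarrow> comm_group (hom_group C X Y)"
    and Comp_Plus_left: "f \<in> Hom C X Y \<Longrightarrow> g \<in> Hom C Y Z \<Longrightarrow> h \<in> Hom C Y Z \<Longrightarrow>
          (g \<boxplus> h) \<cdot> f = (g \<cdot> f) \<boxplus> (h \<cdot> f)"
    and Comp_Plus_right: "f \<in> Hom C X Y \<Longrightarrow> g \<in> Hom C X Y \<Longrightarrow> h \<in> Hom C Y Z \<Longrightarrow>
          h \<cdot> (f \<boxplus> g) = (h \<cdot> f) \<boxplus> (h \<cdot> g)"

definition is_coproduct ::
  "('o, 'm, 'e) preadd_cat_scheme \<Rightarrow> nat \<Rightarrow> (nat \<Rightarrow> 'o) \<Rightarrow> 'o \<Rightarrow> (nat \<Rightarrow> 'm) \<Rightarrow> bool" where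
  "is_coproduct C n A S i \<longleftrightarrow>
     (\<forall>k<n. A k \<in> Obj C) \<and> S \<in> Obj C \<and> (\<forall>k<n. i k \<in> Hom C (A k) S) \<and>
     (\<forall>Z\<in>Obj C. \<forall>g. (\<forall>k<n. g k \<in> Hom C (A k) Z) \<longrightarrow>
        (\<exists>!h. h \<in> Hom C S Z \<and> (\<forall>k<n. h \<cdot>\<^bsub>C\<^esub> i k = g k)))"

text \<open>The case \<open>n = 0\<close> below provides a zero object.\<close>

locale additive_category = preadditive_category C
  for C :: "('o, 'm, 'e) preadd_cat_scheme" (structure) +
  assumes finite_coproducts: "(\<forall>k<n. A k \<in> Obj C) \<Longrightarrow> \<exists>S i. is_coproduct C n A S i"

definition zero_object :: "('o, 'm, 'e) preadd_cat_scheme \<Rightarrow> 'o \<Rightarrow> bool" where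
  "zero_object C X \<longleftrightarrow> X \<in> Obj C \<and>
     (\<forall>Y\<in>Obj C. (\<exists>!f. f \<in> Hom C X Y) \<and> (\<exists>!f. f \<in> Hom C Y X))"

definition indecomposable :: "('o, 'm, 'e) preadd_cat_scheme \<Rightarrow> 'o \<Rightarrow> bool" where
  "indecomposable C X \<longleftrightarrow> X \<in> Obj C \<and> \<not> zero_object C X \<and>
     (\<forall>A i. is_coproduct C 2 A X i \<longrightarrow> zero_object C (A 0) \<or> zero_object C (A 1))"

definition invertible_morphism :: "('o, 'm, 'e) preadd_cat_scheme \<Rightarrow> 'm \<Rightarrow> bool" where
  "invertible_morphism C f \<longleftrightarrow> f \<in> Mor C \<and>
     (\<exists>g\<in>Hom C (Cod C f) (Dom C f).
        g \<cdot>\<^bsub>C\<^esub> f = Ident C (Dom C f) \<and> f \<cdot>\<^bsub>C\<^esub> g = Ident C (Cod C f))"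

text \<open>Noncommutative local rings: nonzero rings whose non-units are closed under addition.\<close>

definition local_ring :: "('a, 'e) ring_scheme \<Rightarrow> bool" where
  "local_ring R \<longleftrightarrow> ring R \<and> \<one>\<^bsub>R\<^esub> \<noteq> \<zero>\<^bsub>R\<^esub> \<and>
     (\<forall>a \<in> carrier R - Units R. \<forall>b \<in> carrier R - Units R. a \<oplus>\<^bsub>R\<^esub> b \<notin> Units R)"

locale krull_schmidt_category = additive_category C
  for C :: "('o, 'm, 'e) preadd_cat_scheme" (structure) +
  assumes local_End: "indecomposable C X \<Longrightarrow> local_ring (End_ring C X)"
    and decomposition:
      "X \<in> Obj C \<Longrightarrow> \<exists>n A i. (\<forall>k<n. indecomposable C (A k)) \<and> is_coproduct C n A X i"


definition cat_ideal :: "('o, 'm, 'e) preadd_cat_scheme \<Rightarrow> 'm set \<Rightarrow> bool" where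
  "cat_ideal C I \<longleftrightarrow> I \<subseteq> Mor C \<and>
     (\<forall>X\<in>Obj C. \<forall>Y\<in>Obj C. Zero C X Y \<in> I) \<and>
     (\<forall>f\<in>I. \<forall>g\<in>I. Dom C f = Dom C g \<longrightarrow> Cod C f = Cod C g \<longrightarrow> f \<boxplus>\<^bsub>C\<^esub> g \<in> I) \<and>
     (\<forall>f\<in>I. \<forall>g\<in>Mor C. Dom C g = Cod C f \<longrightarrow> g \<cdot>\<^bsub>C\<^esub> f \<in> I) \<and>
     (\<forall>f\<in>I. \<forall>g\<in>Mor C. Cod C g = Dom C f \<longrightarrow> f \<cdot>\<^bsub>C\<^esub> g \<in> I)"

definition ideal_generated :: "('o, 'm, 'e) preadd_cat_scheme \<Rightarrow> 'm set \<Rightarrow> 'm set" where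
  "ideal_generated C S = \<Inter>{I. cat_ideal C I \<and> S \<subseteq> I}"

text \<open>
  Compositions of \<open>n\<close>-tuples of morphisms from \<open>I\<close>; for \<open>n = 0\<close> these are the empty
  compositions, so that \<open>n = 1\<close> yields \<open>I\<close> itself by \<open>f \<cdot>\<^bsub>C\<^esub> Ident C X = f\<close>.
\<close>

primrec compositions :: "('o, 'm, 'e) preadd_cat_scheme \<Rightarrow> 'm set \<Rightarrow> nat \<Rightarrow> 'm set" where
  "compositions C I 0 = Ident C ` Obj C"
| "compositions C I (Suc n) =
     {f \<cdot>\<^bsub>C\<^esub> g |f g. f \<in> I \<and> g \<in> compositions C I n \<and> Dom C f = Cod C g}"

definition ideal_power :: "('o, 'm, 'e) preadd_cat_scheme \<Rightarrow> 'm set \<Rightarrow> nat \<Rightarrow> 'm set" where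
  "ideal_power C I n = (if n = 0 then Mor C else ideal_generated C (compositions C I n))"

definition idempotent_ideal :: "('o, 'm, 'e) preadd_cat_scheme \<Rightarrow> 'm set \<Rightarrow> bool" where
  "idempotent_ideal C I \<longleftrightarrow> cat_ideal C I \<and> I = ideal_power C I 2"

definition local_dcc :: "('o, 'm, 'e) preadd_cat_scheme \<Rightarrow> bool" where
  "local_dcc C \<longleftrightarrow>
     (\<forall>J :: nat \<Rightarrow> 'm set. (\<forall>n. cat_ideal C (J n)) \<longrightarrow> (\<forall>n. J (Suc n) \<subseteq> J n) \<longrightarrow>
        (\<forall>X\<in>Obj C. \<forall>Y\<in>Obj C. \<exists>N. \<forall>n\<ge>N. J n \<inter> Hom C X Y = J N \<inter> Hom C X Y))"

definition limit_ordinal :: "'w::wellorder \<Rightarrow> bool" where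
  "limit_ordinal a \<longleftrightarrow> (\<exists>b. b < a) \<and> (\<forall>b<a. \<exists>c. b < c \<and> c < a)"

lemma limit_part_ex1:
  fixes a :: "'w::wellorder"
  assumes "infinite {..<a}" "\<not> limit_ordinal a"
  shows "\<exists>!b. b < a \<and> limit_ordinal b \<and> finite {b..<a}"
proof -
  define b where "b = (LEAST b. finite {b..<a})"
  have fin: "finite {b..<a}"
    unfolding b_def by (rule LeastI[of _ a]) simp
  have le: "b \<le> c" if "finite {c..<a}" for c
    unfolding b_def using that by (rule Least_le)
  obtain z where "z < a"
    using assms(1) by (metis finite.emptyI lessThan_iff equals0I)
  then obtain p where p: "p < a" "\<And>c. p < c \<Longrightarrow> \<not> c < a"
    using assms(2) unfolding limit_ordinal_def by blast
  then have "c = p" if "p \<le> c" "c < a" for c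
    using that by (metis le_less)
  with p(1) have "{p..<a} = {p}"
    by auto
  with p le[of p] have "b < a"
    by auto
  have lim: "limit_ordinal b"
    unfolding limit_ordinal_def
  proof (intro conjI allI impI)
    show "\<exists>c. c < b"
    proof (rule ccontr)
      assume "\<not> ?thesis"
      then have "{..<a} = {b..<a}"
        by (auto simp: not_less)
      with fin assms(1) show False by simp
    qed
    fix c assume "c < b"
    show "\<exists>d>c. d < b"
    proof (rule ccontr)
      assume "\<not> ?thesis"
      then have "d = c \<or> b \<le> d" if "c \<le> d" for d
        using that by (metis le_less not_less)
      then have "{c..<a} \<subseteq> insert c {b..<a}"
        by fastforce
      with fin have "finite {c..<a}"
        by (meson finite_insert finite_subset)
      with le \<open>c < b\<close> show False
        using not_less by blast
    qed
  qed
  have "c = b" if c: "c < a" "limit_ordinal c" "finite {c..<a}" for c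
  proof (rule ccontr)
    assume "c \<noteq> b"
    with le c have "b < c"
      using order_less_le by auto
    have "finite {b..<c}"
      using fin by (rule finite_subset[rotated]) (use c in auto)
    moreover have "{b..<c} \<noteq> {}"
      using \<open>b < c\<close> by auto
    ultimately have "Max {b..<c} < c" "b \<le> Max {b..<c}"
      using Max_in[of "{b..<c}"] by auto
    then obtain d where d: "Max {b..<c} < d" "d < c"
      using c(2) unfolding limit_ordinal_def by blast
    then have "d \<in> {b..<c}"
      using \<open>b \<le> Max {b..<c}\<close> by auto
    then show False
      using Max_ge[OF \<open>finite {b..<c}\<close>] d(1) leD by blast
  qed
  with \<open>b < a\<close> lim fin show ?thesis by blast
qed

text \<open>
  An element \<open>a\<close> of a well-ordered type stands for the order type of \<open>{..<a}\<close>. In the last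
  case \<open>a\<close> is infinite and not a limit, and \<open>a = b + n\<close> for the unique limit ordinal \<open>b < a\<close>
  with \<open>{b..<a}\<close> finite and \<open>n = card {b..<a}\<close>.
\<close>

function transfinite_power ::
  "('o, 'm, 'e) preadd_cat_scheme \<Rightarrow> 'm set \<Rightarrow> 'w::wellorder \<Rightarrow> 'm set" where
  "transfinite_power C I a =
     (if finite {..<a} then ideal_power C I (card {..<a})
      else if limit_ordinal a then (\<Inter>b\<in>{..<a}. transfinite_power C I b)
      else let b = (THE b. b < a \<and> limit_ordinal b \<and> finite {b..<a})
           in ideal_power C (transfinite_power C I b) (card {b..<a} + 1))"
  by pat_completeness auto
termination
proof (relation "{((C, I, b), (C', I', a)). b < a}")
  show "wf {((C :: ('o, 'm, 'e) preadd_cat_scheme, I :: 'm set, b :: 'w::wellorder),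
      (C' :: ('o, 'm, 'e) preadd_cat_scheme, I' :: 'm set, a)). b < a}"
    by (rule wf_subset[OF wf_inv_image[OF wf, of "snd \<circ> snd"]]) (auto simp: inv_image_def)
qed (use theI'[OF limit_part_ex1] in auto)

declare transfinite_power.simps [simp del]

text \<open>
  The intersection of the powers over all ordinals. The decreasing chain of powers loses a
  morphism at every step before it becomes stationary, so it is stationary from some ordinal
  of cardinality at most that of \<open>'m\<close> on, and the ordinals in \<open>'m set ordinal\<close> suffice.
\<close>

definition transfinite_intersection ::
  "('o, 'm, 'e) preadd_cat_scheme \<Rightarrow> 'm set \<Rightarrow> 'm set" where
  "transfinite_intersection C I = (\<Inter>\<alpha> :: 'm set ordinal. transfinite_power C I \<alpha>)"

definition radical :: "('o, 'm, 'e) preadd_cat_scheme \<Rightarrow> 'm set" where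
  "radical C = ideal_generated C
     {f. \<exists>X Y. indecomposable C X \<and> indecomposable C Y \<and> f \<in> Hom C X Y \<and>
               \<not> invertible_morphism C f}"

definition transfinite_radical :: "('o, 'm, 'e) preadd_cat_scheme \<Rightarrow> 'm set" where
  "transfinite_radical C = transfinite_intersection C (radical C)"

end

theory Submission
  imports Defs
begin

text \<open>
  Let \<open>E\<close> be the ideal generated by the identity morphisms in \<open>I\<close> and let \<open>R\<close> be the radical. Since
  \<open>E \<subseteq> I\<close>, it is enough to find for \<open>f \<in> I\<close> a decomposition \<open>f = f\<^sub>1 + f\<^sub>2\<close> with \<open>f\<^sub>1 \<in> E\<close> and
  \<open>f\<^sub>2\<close> in every transfinite power of \<open>R\<close>; then \<open>f\<^sub>2 = f - f\<^sub>1\<close> lies in \<open>I\<close> automatically. The proof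
  is a transfinite induction on \<open>\<alpha>\<close> showing \<open>I \<subseteq> E + R\<^sup>\<alpha>\<close>.

  For \<open>\<alpha> = 1\<close>, the components of a morphism of \<open>I\<close> with respect to decompositions of its domain and
  codomain into indecomposables lie in \<open>I\<close>. A component that is not invertible is in \<open>R\<close> by definition;
  one that is invertible puts the identity of its domain into \<open>I\<close>, so it is in \<open>E\<close>
  (\<open>ideal_subset_identities_plus_radical\<close>).

  To pass from an ideal \<open>J\<close> to \<open>J\<^sup>n\<close>, idempotency is used: if \<open>I \<subseteq> E + J\<close>, then
  \<open>I = I\<^sup>2 \<subseteq> (E + J) (E + J\<^sup>n) \<subseteq> E + J\<^sup>n\<^sup>+\<^sup>1\<close>, because every product with a factor in \<open>E\<close> is absorbed by \<open>E\<close>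
  (\<open>idempotent_subset_sum_power\<close>). This covers all nonzero ordinals that are not
  limits; for \<open>\<alpha> = 0\<close> there is nothing to prove, as \<open>R\<^sup>0\<close> contains all morphisms.

  At a limit ordinal the summand in \<open>R\<^sup>\<beta>\<close> depends on \<open>\<beta>\<close>, and the local descending chain condition is what
  allows a uniform choice: on a fixed \<open>Hom X Y\<close> the decreasing family of the \<open>R\<^sup>\<beta>\<close> with \<open>\<beta> < \<alpha>\<close> has a
  smallest member, which therefore is the intersection (\<open>local_dcc_least\<close>). The same argument, applied to
  the family of all powers, finally replaces the single powers by their intersection.
\<close>

section \<open>Arithmetic in preadditive categories\<close>

lemma Hom_objects:
  assumes "preadditive_category C" "f \<in> Hom C X Y"
  shows "X \<in> Obj C" "Y \<in> Obj C"
  using assms preadditive_category.Dom_in_Obj preadditive_category.Cod_in_Obj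
  unfolding Hom_def by fastforce+

context preadditive_category
begin

lemma Zero_in_Hom: "X \<in> Obj C \<Longrightarrow> Y \<in> Obj C \<Longrightarrow> Zero C X Y \<in> Hom C X Y"
  using comm_group_Hom[of X Y] by (auto simp: hom_group_def comm_group_def group_def dest: monoid.one_closed)

lemma Plus_in_Hom:
  assumes "f \<in> Hom C X Y" "g \<in> Hom C X Y"
  shows "f \<boxplus> g \<in> Hom C X Y"
proof -
  interpret G: comm_group "hom_group C X Y"
    using comm_group_Hom Hom_objects[OF preadditive_category_axioms assms(1)] by blast
  show ?thesis using G.m_closed assms by (simp add: hom_group_def)
qed

lemma Plus_assoc:
  assumes "f \<in> Hom C X Y" "g \<in> Hom C X Y" "h \<in> Hom C X Y"
  shows "f \<boxplus> g \<boxplus> h = f \<boxplus> (g \<boxplus> h)"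
proof -
  interpret G: comm_group "hom_group C X Y"
    using comm_group_Hom Hom_objects[OF preadditive_category_axioms assms(1)] by blast
  show ?thesis using G.m_assoc assms by (simp add: hom_group_def)
qed

lemma Plus_commute:
  assumes "f \<in> Hom C X Y" "g \<in> Hom C X Y"
  shows "f \<boxplus> g = g \<boxplus> f"
proof -
  interpret G: comm_group "hom_group C X Y"
    using comm_group_Hom Hom_objects[OF preadditive_category_axioms assms(1)] by blast
  show ?thesis using G.m_comm assms by (simp add: hom_group_def)
qed

lemma Zero_Plus:
  assumes "f \<in> Hom C X Y"
  shows "Zero C X Y \<boxplus> f = f"
proof -
  interpret G: comm_group "hom_group C X Y"
    using comm_group_Hom Hom_objects[OF preadditive_category_axioms assms(1)] by blast
  show ?thesis using G.l_one assms by (simp add: hom_group_def)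
qed

lemma Plus_Zero:
  assumes "f \<in> Hom C X Y"
  shows "f \<boxplus> Zero C X Y = f"
  using assms Plus_commute Zero_Plus Zero_in_Hom Hom_objects[OF preadditive_category_axioms assms]
  by metis

lemma Plus_inverse:
  assumes "f \<in> Hom C X Y"
  obtains g where "g \<in> Hom C X Y" "f \<boxplus> g = Zero C X Y"
proof -
  interpret G: comm_group "hom_group C X Y"
    using comm_group_Hom Hom_objects[OF preadditive_category_axioms assms(1)] by blast
  show ?thesis using that G.r_inv[of f] G.inv_closed[of f] assms by (simp add: hom_group_def)
qed

lemma Plus_self_imp_Zero:
  assumes "f \<in> Hom C X Y" "f \<boxplus> f = f"
  shows "f = Zero C X Y"
proof -
  interpret G: comm_group "hom_group C X Y"
    using comm_group_Hom Hom_objects[OF preadditive_category_axioms assms(1)] by blast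
  show ?thesis using G.l_cancel_one[of f f] assms by (simp add: hom_group_def)
qed

lemma Comp_Zero:
  assumes "g \<in> Hom C Y Z" "X \<in> Obj C"
  shows "g \<cdot> Zero C X Y = Zero C X Z"
proof -
  have z: "Zero C X Y \<in> Hom C X Y"
    using Zero_in_Hom Hom_objects[OF preadditive_category_axioms assms(1)] assms(2) by blast
  have "g \<cdot> Zero C X Y \<boxplus> g \<cdot> Zero C X Y = g \<cdot> Zero C X Y"
    using Comp_Plus_right[OF z z assms(1)] Zero_Plus[OF z] by simp
  then show ?thesis by (rule Plus_self_imp_Zero[OF Comp_in_Hom[OF z assms(1)]])
qed

lemma Zero_Comp:
  assumes "f \<in> Hom C X Y" "Z \<in> Obj C"
  shows "Zero C Y Z \<cdot> f = Zero C X Z"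
proof -
  have z: "Zero C Y Z \<in> Hom C Y Z"
    using Zero_in_Hom Hom_objects[OF preadditive_category_axioms assms(1)] assms(2) by blast
  have "Zero C Y Z \<cdot> f \<boxplus> Zero C Y Z \<cdot> f = Zero C Y Z \<cdot> f"
    using Comp_Plus_left[OF assms(1) z z] Zero_Plus[OF z] by simp
  then show ?thesis by (rule Plus_self_imp_Zero[OF Comp_in_Hom[OF assms(1) z]])
qed

section \<open>Ideals, sums of ideals and powers of ideals\<close>

lemma cat_idealI:
  assumes "I \<subseteq> Mor C"
    and "\<And>X Y. X \<in> Obj C \<Longrightarrow> Y \<in> Obj C \<Longrightarrow> Zero C X Y \<in> I"
    and "\<And>X Y f g. f \<in> I \<Longrightarrow> g \<in> I \<Longrightarrow> f \<in> Hom C X Y \<Longrightarrow> g \<in> Hom C X Y \<Longrightarrow> f \<boxplus> g \<in> I"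
    and "\<And>X Y Z f g. f \<in> I \<Longrightarrow> f \<in> Hom C X Y \<Longrightarrow> g \<in> Hom C Y Z \<Longrightarrow> g \<cdot> f \<in> I"
    and "\<And>X Y Z f g. f \<in> I \<Longrightarrow> f \<in> Hom C Y Z \<Longrightarrow> g \<in> Hom C X Y \<Longrightarrow> f \<cdot> g \<in> I"
  shows "cat_ideal C I"
  unfolding cat_ideal_def using assms unfolding Hom_def by (auto simp: subset_iff)

lemma cat_ideal_Mor: "cat_ideal C (Mor C)"
  using Zero_in_Hom Plus_in_Hom Comp_in_Hom
  by (intro cat_idealI) (fastforce simp: Hom_def)+

end

lemma cat_ideal_subset_Mor: "cat_ideal C I \<Longrightarrow> f \<in> I \<Longrightarrow> f \<in> Mor C"
  unfolding cat_ideal_def by blast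

lemma ideal_Zero: "cat_ideal C I \<Longrightarrow> X \<in> Obj C \<Longrightarrow> Y \<in> Obj C \<Longrightarrow> Zero C X Y \<in> I"
  unfolding cat_ideal_def by blast

lemma ideal_Plus:
  "cat_ideal C I \<Longrightarrow> f \<in> I \<Longrightarrow> g \<in> I \<Longrightarrow> f \<in> Hom C X Y \<Longrightarrow> g \<in> Hom C X Y \<Longrightarrow> Plus C f g \<in> I"
  unfolding cat_ideal_def Hom_def by auto

lemma ideal_Comp_left:
  "cat_ideal C I \<Longrightarrow> f \<in> I \<Longrightarrow> f \<in> Hom C X Y \<Longrightarrow> g \<in> Hom C Y Z \<Longrightarrow> Comp C g f \<in> I"
  unfolding cat_ideal_def Hom_def by auto

lemma ideal_Comp_right:
  "cat_ideal C I \<Longrightarrow> f \<in> I \<Longrightarrow> f \<in> Hom C Y Z \<Longrightarrow> g \<in> Hom C X Y \<Longrightarrow> Comp C f g \<in> I"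
  unfolding cat_ideal_def Hom_def by auto

context preadditive_category
begin

lemma cat_ideal_Inter:
  assumes "\<And>I. I \<in> A \<Longrightarrow> cat_ideal C I" "A \<noteq> {}"
  shows "cat_ideal C (\<Inter>A)"
proof (rule cat_idealI)
  obtain I where "I \<in> A" using assms(2) by blast
  then show "\<Inter>A \<subseteq> Mor C" using cat_ideal_subset_Mor[OF assms(1)] by blast
  show "Zero C X Y \<in> \<Inter>A" if "X \<in> Obj C" "Y \<in> Obj C" for X Y
    using ideal_Zero[OF assms(1) that] by (rule InterI)
  show "f \<boxplus> g \<in> \<Inter>A"
    if "f \<in> \<Inter>A" "g \<in> \<Inter>A" "f \<in> Hom C X Y" "g \<in> Hom C X Y" for X Y f g
    using ideal_Plus[OF assms(1) _ _ that(3,4)] that(1,2) by (simp add: Inter_iff)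
  show "g \<cdot> f \<in> \<Inter>A"
    if "f \<in> \<Inter>A" "f \<in> Hom C X Y" "g \<in> Hom C Y Z" for X Y Z f g
    using ideal_Comp_left[OF assms(1) _ that(2,3)] that(1) by (simp add: Inter_iff)
  show "f \<cdot> g \<in> \<Inter>A"
    if "f \<in> \<Inter>A" "f \<in> Hom C Y Z" "g \<in> Hom C X Y" for X Y Z f g
    using ideal_Comp_right[OF assms(1) _ that(2,3)] that(1) by (simp add: Inter_iff)
qed

lemma cat_ideal_generated:
  assumes "S \<subseteq> Mor C"
  shows "cat_ideal C (ideal_generated C S)"
  unfolding ideal_generated_def using assms cat_ideal_Mor by (intro cat_ideal_Inter) auto

lemma compositions_subset_Mor:
  assumes "cat_ideal C I"
  shows "compositions C I n \<subseteq> Mor C"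
proof (induction n)
  case 0
  show ?case using Ident_in_Hom by (auto simp: Hom_def)
next
  case (Suc n)
  then show ?case using assms unfolding cat_ideal_def by (auto simp: subset_iff)
qed

lemma cat_ideal_power: "cat_ideal C I \<Longrightarrow> cat_ideal C (ideal_power C I n)"
  unfolding ideal_power_def using cat_ideal_Mor cat_ideal_generated compositions_subset_Mor by simp

end

lemma ideal_generated_least: "cat_ideal C I \<Longrightarrow> S \<subseteq> I \<Longrightarrow> ideal_generated C S \<subseteq> I"
  unfolding ideal_generated_def by blast

lemma subset_ideal_generated: "S \<subseteq> ideal_generated C S"
  unfolding ideal_generated_def by blast

definition ideal_sum :: "('o, 'm, 'e) preadd_cat_scheme \<Rightarrow> 'm set \<Rightarrow> 'm set \<Rightarrow> 'm set" where
  "ideal_sum C E J = {Plus C e j |e j X Y. e \<in> E \<and> j \<in> J \<and> e \<in> Hom C X Y \<and> j \<in> Hom C X Y}"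

lemma ideal_sumI:
  "e \<in> E \<Longrightarrow> j \<in> J \<Longrightarrow> e \<in> Hom C X Y \<Longrightarrow> j \<in> Hom C X Y \<Longrightarrow> Plus C e j \<in> ideal_sum C E J"
  unfolding ideal_sum_def by blast

context preadditive_category
begin

lemma ideal_sumE:
  assumes "f \<in> ideal_sum C E J" "f \<in> Hom C X Y"
  obtains e j where "e \<in> E" "j \<in> J" "e \<in> Hom C X Y" "j \<in> Hom C X Y" "f = e \<boxplus> j"
proof -
  from assms(1) obtain e j X' Y' where ej: "e \<in> E" "j \<in> J" "e \<in> Hom C X' Y'" "j \<in> Hom C X' Y'" "f = e \<boxplus> j"
    unfolding ideal_sum_def by blast
  then have "f \<in> Hom C X' Y'" using Plus_in_Hom by blast
  with assms(2) have "X' = X" "Y' = Y" by (auto simp: Hom_def)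
  with ej that show thesis by blast
qed

lemma cat_ideal_sum:
  assumes E: "cat_ideal C E" and J: "cat_ideal C J"
  shows "cat_ideal C (ideal_sum C E J)"
proof (rule cat_idealI)
  show "ideal_sum C E J \<subseteq> Mor C"
    unfolding ideal_sum_def using Plus_in_Hom by (fastforce simp: Hom_def)
next
  fix X Y assume "X \<in> Obj C" "Y \<in> Obj C"
  then show "Zero C X Y \<in> ideal_sum C E J"
    using ideal_sumI[of "Zero C X Y" E "Zero C X Y" J] ideal_Zero[OF E] ideal_Zero[OF J]
      Zero_in_Hom Zero_Plus by metis
next
  fix X Y f g
  assume "f \<in> ideal_sum C E J" "g \<in> ideal_sum C E J" and fg: "f \<in> Hom C X Y" "g \<in> Hom C X Y"
  then obtain e j where f: "e \<in> E" "j \<in> J" "e \<in> Hom C X Y" "j \<in> Hom C X Y" "f = e \<boxplus> j"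
    by (blast elim: ideal_sumE)
  from \<open>g \<in> ideal_sum C E J\<close> fg(2)
  obtain e' j' where g: "e' \<in> E" "j' \<in> J" "e' \<in> Hom C X Y" "j' \<in> Hom C X Y" "g = e' \<boxplus> j'"
    by (blast elim: ideal_sumE)
  have "f \<boxplus> g = e \<boxplus> (j \<boxplus> e' \<boxplus> j')"
    using f g by (simp add: Plus_assoc[of _ X Y] Plus_in_Hom[of _ X Y])
  also have "\<dots> = e \<boxplus> (e' \<boxplus> j \<boxplus> j')"
    using Plus_commute[OF f(4) g(3)] by simp
  also have "\<dots> = (e \<boxplus> e') \<boxplus> (j \<boxplus> j')"
    using f g by (simp add: Plus_assoc[of _ X Y] Plus_in_Hom[of _ X Y])
  finally show "f \<boxplus> g \<in> ideal_sum C E J"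
    using ideal_sumI[OF ideal_Plus[OF E f(1) g(1) f(3) g(3)] ideal_Plus[OF J f(2) g(2) f(4) g(4)]
        Plus_in_Hom[OF f(3) g(3)] Plus_in_Hom[OF f(4) g(4)]] by simp
next
  fix X Y Z f g
  assume "f \<in> ideal_sum C E J" "f \<in> Hom C X Y" and g: "g \<in> Hom C Y Z"
  then obtain e j where f: "e \<in> E" "j \<in> J" "e \<in> Hom C X Y" "j \<in> Hom C X Y" "f = e \<boxplus> j"
    by (blast elim: ideal_sumE)
  then have "g \<cdot> f = g \<cdot> e \<boxplus> g \<cdot> j" using g Comp_Plus_right by blast
  then show "g \<cdot> f \<in> ideal_sum C E J"
    using ideal_sumI[OF ideal_Comp_left[OF E f(1,3) g] ideal_Comp_left[OF J f(2,4) g]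
        Comp_in_Hom[OF f(3) g] Comp_in_Hom[OF f(4) g]] by simp
next
  fix X Y Z f g
  assume "f \<in> ideal_sum C E J" "f \<in> Hom C Y Z" and g: "g \<in> Hom C X Y"
  then obtain e j where f: "e \<in> E" "j \<in> J" "e \<in> Hom C Y Z" "j \<in> Hom C Y Z" "f = e \<boxplus> j"
    by (blast elim: ideal_sumE)
  then have "f \<cdot> g = e \<cdot> g \<boxplus> j \<cdot> g" using g Comp_Plus_left by blast
  then show "f \<cdot> g \<in> ideal_sum C E J"
    using ideal_sumI[OF ideal_Comp_right[OF E f(1,3) g] ideal_Comp_right[OF J f(2,4) g]
        Comp_in_Hom[OF g f(3)] Comp_in_Hom[OF g f(4)]] by simp
qed

lemma left_subset_ideal_sum:
  assumes "cat_ideal C E" "cat_ideal C J"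
  shows "E \<subseteq> ideal_sum C E J"
proof
  fix e assume e: "e \<in> E"
  define X Y where "X = Dom C e" "Y = Cod C e"
  then have h: "e \<in> Hom C X Y" using cat_ideal_subset_Mor[OF assms(1) e] by (simp add: Hom_def)
  then have "Zero C X Y \<in> J" "Zero C X Y \<in> Hom C X Y"
    using Hom_objects[OF preadditive_category_axioms h] ideal_Zero[OF assms(2)] Zero_in_Hom by auto
  then show "e \<in> ideal_sum C E J" using ideal_sumI[OF e _ h] Plus_Zero[OF h] by metis
qed

lemma right_subset_ideal_sum:
  assumes "cat_ideal C E" "cat_ideal C J"
  shows "J \<subseteq> ideal_sum C E J"
proof
  fix j assume j: "j \<in> J"
  define X Y where "X = Dom C j" "Y = Cod C j"
  then have h: "j \<in> Hom C X Y" using cat_ideal_subset_Mor[OF assms(2) j] by (simp add: Hom_def)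
  then have "Zero C X Y \<in> E" "Zero C X Y \<in> Hom C X Y"
    using Hom_objects[OF preadditive_category_axioms h] ideal_Zero[OF assms(1)] Zero_in_Hom by auto
  then show "j \<in> ideal_sum C E J" using ideal_sumI[OF _ j _ h] Zero_Plus[OF h] by metis
qed

lemma subset_ideal_power_1:
  assumes "cat_ideal C J"
  shows "J \<subseteq> ideal_power C J 1"
proof
  fix j assume j: "j \<in> J"
  then have h: "j \<in> Hom C (Dom C j) (Cod C j)"
    using cat_ideal_subset_Mor[OF assms] by (simp add: Hom_def)
  have "j \<cdot> Ident C (Dom C j) \<in> compositions C J 1"
    using j Ident_in_Hom Hom_objects[OF preadditive_category_axioms h] by (fastforce simp: Hom_def)
  then have "j \<in> compositions C J 1" using Comp_Ident[OF h] by simp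
  then show "j \<in> ideal_power C J 1"
    using subset_ideal_generated[of "compositions C J 1" C] by (auto simp: ideal_power_def)
qed

text \<open>
  The generators of \<open>J\<^sup>n\<^sup>+\<^sup>1\<close> are products of an element of \<open>J\<close> with a generator of \<open>J\<^sup>n\<close>. To allow
  arbitrary elements of \<open>J\<^sup>n\<close> as second factor, the admissible second factors are shown to form an ideal.
\<close>

lemma Comp_in_ideal_power_Suc:
  assumes J: "cat_ideal C J" and n: "n > 0"
    and "f \<in> J" "f \<in> Hom C Y Z" "g \<in> ideal_power C J n" "g \<in> Hom C X Y"
  shows "f \<cdot> g \<in> ideal_power C J (Suc n)"
proof -
  note P = cat_ideal_power[OF J, of "Suc n"]
  define K where "K = {g \<in> Mor C. \<forall>j\<in>J. Dom C j = Cod C g \<longrightarrow> j \<cdot> g \<in> ideal_power C J (Suc n)}"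
  have KI: "g \<in> K" if "g \<in> Hom C X Y"
    "\<And>j Z. j \<in> J \<Longrightarrow> j \<in> Hom C Y Z \<Longrightarrow> j \<cdot> g \<in> ideal_power C J (Suc n)" for g X Y
    using that cat_ideal_subset_Mor[OF J] unfolding K_def Hom_def by blast
  have KD: "j \<cdot> g \<in> ideal_power C J (Suc n)"
    if "g \<in> K" "g \<in> Hom C X Y" "j \<in> J" "j \<in> Hom C Y Z" for g X Y Z j
    using that unfolding K_def Hom_def by blast
  have "cat_ideal C K"
  proof (rule cat_idealI)
    show "K \<subseteq> Mor C" unfolding K_def by blast
  next
    fix X Y assume XY: "X \<in> Obj C" "Y \<in> Obj C"
    show "Zero C X Y \<in> K"
    proof (rule KI[OF Zero_in_Hom[OF XY]])
      fix j Z assume "j \<in> Hom C Y Z"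
      then show "j \<cdot> Zero C X Y \<in> ideal_power C J (Suc n)"
        using Comp_Zero XY(1) ideal_Zero[OF P XY(1)] Hom_objects(2)[OF preadditive_category_axioms] by simp
    qed
  next
    fix X Y f g assume K: "f \<in> K" "g \<in> K" and h: "f \<in> Hom C X Y" "g \<in> Hom C X Y"
    show "f \<boxplus> g \<in> K"
    proof (rule KI[OF Plus_in_Hom[OF h]])
      fix j Z assume j: "j \<in> J" "j \<in> Hom C Y Z"
      show "j \<cdot> (f \<boxplus> g) \<in> ideal_power C J (Suc n)"
        unfolding Comp_Plus_right[OF h j(2)]
        by (rule ideal_Plus[OF P KD[OF K(1) h(1) j] KD[OF K(2) h(2) j]
              Comp_in_Hom[OF h(1) j(2)] Comp_in_Hom[OF h(2) j(2)]])
    qed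
  next
    fix X Y Z f g assume K: "f \<in> K" and h: "f \<in> Hom C X Y" "g \<in> Hom C Y Z"
    show "g \<cdot> f \<in> K"
    proof (rule KI[OF Comp_in_Hom[OF h]])
      fix j W assume j: "j \<in> J" "j \<in> Hom C Z W"
      show "j \<cdot> (g \<cdot> f) \<in> ideal_power C J (Suc n)"
        using KD[OF K h(1) ideal_Comp_right[OF J j h(2)] Comp_in_Hom[OF h(2) j(2)]]
        unfolding Comp_assoc[OF h j(2)] .
    qed
  next
    fix X Y Z f g assume K: "f \<in> K" and h: "f \<in> Hom C Y Z" "g \<in> Hom C X Y"
    show "f \<cdot> g \<in> K"
    proof (rule KI[OF Comp_in_Hom[OF h(2,1)]])
      fix j W assume j: "j \<in> J" "j \<in> Hom C Z W"
      show "j \<cdot> (f \<cdot> g) \<in> ideal_power C J (Suc n)"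
        using ideal_Comp_right[OF P KD[OF K h(1) j] Comp_in_Hom[OF h(1) j(2)] h(2)]
        unfolding Comp_assoc[OF h(2,1) j(2)] .
    qed
  qed
  moreover have "compositions C J n \<subseteq> K"
    using compositions_subset_Mor[OF J, of n] subset_ideal_generated[of "compositions C J (Suc n)" C]
    unfolding K_def ideal_power_def by auto
  ultimately have "ideal_power C J n \<subseteq> K"
    using n ideal_generated_least unfolding ideal_power_def by simp
  then show ?thesis using KD assms by blast
qed

lemma ideal_power_Suc_subset:
  assumes "cat_ideal C J"
  shows "ideal_power C J (Suc n) \<subseteq> ideal_power C J n"
proof (cases "n = 0")
  case True
  then show ?thesis
    using cat_ideal_power[OF assms, of "Suc n"] by (auto simp: ideal_power_def cat_ideal_def)
next
  case False
  have "compositions C J (Suc n) \<subseteq> ideal_power C J n"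
  proof
    fix h assume "h \<in> compositions C J (Suc n)"
    then obtain f g where fg: "h = f \<cdot> g" "f \<in> J" "g \<in> compositions C J n" "Dom C f = Cod C g"
      by auto
    then have "g \<in> ideal_power C J n" "f \<in> Mor C"
      using False subset_ideal_generated[of "compositions C J n" C] cat_ideal_subset_Mor[OF assms]
      by (auto simp: ideal_power_def)
    then show "h \<in> ideal_power C J n"
      using fg cat_ideal_power[OF assms, of n] unfolding cat_ideal_def by auto
  qed
  then show ?thesis
    using ideal_generated_least[OF cat_ideal_power[OF assms, of n]] by (simp add: ideal_power_def)
qed

lemma ideal_power_antimono:
  assumes "cat_ideal C J" "m \<le> n"
  shows "ideal_power C J n \<subseteq> ideal_power C J m"
  using assms(2) ideal_power_Suc_subset[OF assms(1)] by (rule lift_Suc_antimono_le[rotated])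

lemma ideal_power_1: "cat_ideal C J \<Longrightarrow> ideal_power C J 1 = J"
proof (rule equalityI[OF _ subset_ideal_power_1])
  assume J: "cat_ideal C J"
  have "compositions C J 1 \<subseteq> J"
    using Ident_in_Hom J unfolding cat_ideal_def Hom_def by auto
  then show "ideal_power C J 1 \<subseteq> J"
    using ideal_generated_least[OF J] by (simp add: ideal_power_def)
qed

text \<open>
  Expanding \<open>(E + J) (E + J\<^sup>n)\<close>, only the product \<open>J J\<^sup>n\<close> is not absorbed by \<open>E\<close>.
\<close>

lemma idempotent_subset_sum_power:
  assumes I: "idempotent_ideal C I" and E: "cat_ideal C E" and J: "cat_ideal C J"
    and sub: "I \<subseteq> ideal_sum C E J" and "n > 0"
  shows "I \<subseteq> ideal_sum C E (ideal_power C J n)"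
  using \<open>n > 0\<close>
proof (induction n rule: nat_induct_non_zero)
  case 1
  then show ?case using sub ideal_power_1[OF J] by simp
next
  case (Suc n)
  let ?S = "ideal_sum C E (ideal_power C J (Suc n))"
  have I': "cat_ideal C I" and II: "I = ideal_generated C (compositions C I 2)"
    using I by (auto simp: idempotent_ideal_def ideal_power_def)
  note P = cat_ideal_power[OF J, of "Suc n"]
  note S = cat_ideal_sum[OF E P]
  have "compositions C I 2 \<subseteq> ?S"
  proof
    fix h assume "h \<in> compositions C I 2"
    then obtain f g X where h: "h = f \<cdot> (g \<cdot> Ident C X)" "f \<in> I" "g \<in> I" "X \<in> Obj C"
      "Dom C g = Cod C (Ident C X)" "Dom C f = Cod C (g \<cdot> Ident C X)"
      by (auto simp: numeral_2_eq_2)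
    then have g': "g \<in> Hom C X (Cod C g)"
      using Ident_in_Hom[of X] cat_ideal_subset_Mor[OF I', of g] by (auto simp: Hom_def)
    define Y Z where "Y = Cod C g" "Z = Cod C f"
    have g: "g \<in> Hom C X Y" using g' Y_Z_def by simp
    have f: "f \<in> Hom C Y Z"
      using h Y_Z_def Comp_Ident[OF g] cat_ideal_subset_Mor[OF I', of f] by (simp add: Hom_def)
    have hfg: "h = f \<cdot> g" using h Comp_Ident[OF g] by simp
    obtain e j where ej: "e \<in> E" "j \<in> J" "e \<in> Hom C Y Z" "j \<in> Hom C Y Z" "f = e \<boxplus> j"
      using ideal_sumE f sub h(2) by blast
    obtain e' j' where ej': "e' \<in> E" "j' \<in> ideal_power C J n" "e' \<in> Hom C X Y" "j' \<in> Hom C X Y"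
      "g = e' \<boxplus> j'"
      using ideal_sumE g Suc.IH h(3) by blast
    have "h = e \<cdot> g \<boxplus> (j \<cdot> e' \<boxplus> j \<cdot> j')"
      using ej ej' g hfg Comp_Plus_left Comp_Plus_right by metis
    also have "\<dots> = (e \<cdot> g \<boxplus> j \<cdot> e') \<boxplus> j \<cdot> j'"
      using ej ej' g Plus_assoc Comp_in_Hom by metis
    finally have eq: "h = (e \<cdot> g \<boxplus> j \<cdot> e') \<boxplus> j \<cdot> j'" .
    have "e \<cdot> g \<in> E" "j \<cdot> e' \<in> E"
      using ej ej' g ideal_Comp_left[OF E] ideal_Comp_right[OF E] by blast+
    then have "e \<cdot> g \<boxplus> j \<cdot> e' \<in> E"
      using ej ej' g ideal_Plus[OF E] Comp_in_Hom by blast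
    moreover have "j \<cdot> j' \<in> ideal_power C J (Suc n)"
      using Comp_in_ideal_power_Suc[OF J Suc.hyps] ej ej' by blast
    ultimately show "h \<in> ?S"
      unfolding eq using ej ej' g Plus_in_Hom Comp_in_Hom by (blast intro: ideal_sumI)
  qed
  then show ?case using II ideal_generated_least[OF S] by metis
qed

section \<open>Transfinite powers\<close>

lemma transfinite_power_finite:
  "finite {..<a} \<Longrightarrow> transfinite_power C J a = ideal_power C J (card {..<a})"
  by (subst transfinite_power.simps) simp

lemma transfinite_power_limit:
  "infinite {..<a} \<Longrightarrow> limit_ordinal a \<Longrightarrow>
    transfinite_power C J a = (\<Inter>b\<in>{..<a}. transfinite_power C J b)"
  by (subst transfinite_power.simps) simp

lemma transfinite_power_successor:
  assumes "infinite {..<a}" "\<not> limit_ordinal a" "b < a" "limit_ordinal b" "finite {b..<a}"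
  shows "transfinite_power C J a = ideal_power C (transfinite_power C J b) (card {b..<a} + 1)"
proof -
  have "(THE b. b < a \<and> limit_ordinal b \<and> finite {b..<a}) = b"
    using limit_part_ex1[OF assms(1,2)] assms(3-) by (intro the1_equality) auto
  then show ?thesis using assms(1,2) by (subst transfinite_power.simps) simp
qed

lemma cat_ideal_transfinite_power:
  fixes a :: "'w::wellorder"
  assumes J: "cat_ideal C J"
  shows "cat_ideal C (transfinite_power C J a)"
proof (induction a rule: less_induct)
  case (less a)
  consider "finite {..<a}" | "infinite {..<a}" "limit_ordinal a" | "infinite {..<a}" "\<not> limit_ordinal a"
    by blast
  then show ?case
  proof cases
    case 1
    then show ?thesis using transfinite_power_finite cat_ideal_power[OF J] by metis
  next
    case 2
    then have "{..<a} \<noteq> {}" by auto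
    with 2 less show ?thesis unfolding transfinite_power_limit[OF 2] by (intro cat_ideal_Inter) auto
  next
    case 3
    then show ?thesis
      using limit_part_ex1[OF 3] transfinite_power_successor[OF 3] less cat_ideal_power by metis
  qed
qed

text \<open>
  The case that needs an argument is \<open>b = c + n\<close> with \<open>c\<close> a limit and \<open>c < a < b\<close>: then \<open>a\<close> has the same
  limit part \<open>c\<close> as \<open>b\<close>, and both powers are finite powers of the same ideal.
\<close>

lemma transfinite_power_antimono:
  fixes a b :: "'w::wellorder"
  assumes J: "cat_ideal C J" and "a \<le> b"
  shows "transfinite_power C J b \<subseteq> transfinite_power C J a"
  using \<open>a \<le> b\<close>
proof (induction b arbitrary: a rule: less_induct)
  case (less b)
  show ?case
  proof (cases "a = b")
    case False
    with less.prems have ab: "a < b" by simp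
    then have sub: "{..<a} \<subseteq> {..<b}" by auto
    consider "finite {..<b}" | "infinite {..<b}" "limit_ordinal b" | "infinite {..<b}" "\<not> limit_ordinal b"
      by blast
    then show ?thesis
    proof cases
      case 1
      then have "finite {..<a}" "card {..<a} \<le> card {..<b}"
        using finite_subset[OF sub] card_mono[OF 1 sub] by simp_all
      with 1 show ?thesis using ideal_power_antimono[OF J] by (simp add: transfinite_power_finite)
    next
      case 2
      then show ?thesis unfolding transfinite_power_limit[OF 2] using ab by blast
    next
      case 3
      then obtain c where c: "c < b" "limit_ordinal c" "finite {c..<b}"
        and uniq: "\<And>d. d < b \<Longrightarrow> limit_ordinal d \<Longrightarrow> finite {d..<b} \<Longrightarrow> d = c"
        using limit_part_ex1[OF 3] by blast
      note T = cat_ideal_transfinite_power[OF J]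
      note b = transfinite_power_successor[OF 3 c]
      show ?thesis
      proof (cases "a \<le> c")
        case True
        have "transfinite_power C J b \<subseteq> ideal_power C (transfinite_power C J c) 1"
          unfolding b by (rule ideal_power_antimono[OF T]) simp
        also have "\<dots> = transfinite_power C J c" by (rule ideal_power_1[OF T])
        also have "\<dots> \<subseteq> transfinite_power C J a" using less.IH c(1) True by blast
        finally show ?thesis .
      next
        case False
        then have ca: "c < a" by simp
        have fin: "finite {a..<b}" using c(3) ca by (rule_tac finite_subset[of _ "{c..<b}"]) auto
        have "{..<b} = {..<a} \<union> {a..<b}" using ab by auto
        then have inf: "infinite {..<a}" using 3(1) fin by auto
        have nl: "\<not> limit_ordinal a" using uniq[OF ab _ fin] ca by auto
        have sub: "{c..<a} \<subseteq> {c..<b}" using ab by auto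
        have fin': "finite {c..<a}" using sub c(3) finite_subset by blast
        show ?thesis
          unfolding b transfinite_power_successor[OF inf nl ca c(2) fin']
          using card_mono[OF c(3) sub] by (intro ideal_power_antimono[OF T]) simp
      qed
    qed
  qed simp
qed

end

section \<open>The local descending chain condition\<close>

text \<open>
  Without a smallest member one could choose inductively an infinite sequence of members of the family that
  decreases strictly on \<open>Hom X Y\<close>.
\<close>

lemma local_dcc_least:
  fixes T :: "'w::linorder \<Rightarrow> 'm set"
  assumes dcc: "local_dcc C" and T: "\<And>a. cat_ideal C (T a)"
    and anti: "\<And>a b. a \<le> b \<Longrightarrow> T b \<subseteq> T a"
    and S: "S \<noteq> {}" and X: "X \<in> Obj C" and Y: "Y \<in> Obj C"
  obtains b where "b \<in> S" "\<And>c. c \<in> S \<Longrightarrow> T b \<inter> Hom C X Y \<subseteq> T c"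
proof (rule ccontr)
  assume "\<not> thesis"
  then have "\<exists>c. c \<in> S \<and> \<not> T b \<inter> Hom C X Y \<subseteq> T c" if "b \<in> S" for b
    using that \<open>\<And>b. b \<in> S \<Longrightarrow> (\<And>c. c \<in> S \<Longrightarrow> T b \<inter> Hom C X Y \<subseteq> T c) \<Longrightarrow> thesis\<close> by blast
  then obtain s where s: "\<And>n. s n \<in> S" "\<And>n. \<not> T (s n) \<inter> Hom C X Y \<subseteq> T (s (Suc n))"
    using dependent_nat_choice[of "\<lambda>_ b. b \<in> S" "\<lambda>_ b c. \<not> T b \<inter> Hom C X Y \<subseteq> T c"] S by blast
  have dec: "T (s (Suc n)) \<subseteq> T (s n)" for n
  proof (rule anti)
    have "\<not> s (Suc n) \<le> s n" using anti[of "s (Suc n)" "s n"] s(2)[of n] by blast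
    then show "s n \<le> s (Suc n)" by simp
  qed
  have "\<exists>N. \<forall>n\<ge>N. T (s n) \<inter> Hom C X Y = T (s N) \<inter> Hom C X Y"
    by (rule dcc[unfolded local_dcc_def, rule_format, of "\<lambda>n. T (s n)", OF T dec X Y])
  then obtain N where "\<forall>n\<ge>N. T (s n) \<inter> Hom C X Y = T (s N) \<inter> Hom C X Y" ..
  then have "T (s (Suc N)) \<inter> Hom C X Y = T (s N) \<inter> Hom C X Y"
    by (meson le_SucI order_refl)
  then have "T (s N) \<inter> Hom C X Y \<subseteq> T (s (Suc N))" by (metis Int_lower1)
  with s(2)[of N] show False by (rule notE)
qed

context preadditive_category
begin

lemma subset_sum_Inter:
  fixes T :: "'w::linorder \<Rightarrow> 'm set"
  assumes dcc: "local_dcc C" and T: "\<And>a. cat_ideal C (T a)"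
    and anti: "\<And>a b. a \<le> b \<Longrightarrow> T b \<subseteq> T a"
    and S: "S \<noteq> {}" and I: "I \<subseteq> Mor C" and sub: "\<And>a. a \<in> S \<Longrightarrow> I \<subseteq> ideal_sum C E (T a)"
  shows "I \<subseteq> ideal_sum C E (\<Inter>a\<in>S. T a)"
proof
  fix f assume f: "f \<in> I"
  define X Y where "X = Dom C f" "Y = Cod C f"
  then have h: "f \<in> Hom C X Y" using f I by (auto simp: Hom_def)
  obtain b where b: "b \<in> S" "\<And>c. c \<in> S \<Longrightarrow> T b \<inter> Hom C X Y \<subseteq> T c"
    using local_dcc_least[of C T S X Y, OF dcc T anti S Hom_objects[OF preadditive_category_axioms h]]
    by blast
  obtain e t where et: "e \<in> E" "t \<in> T b" "e \<in> Hom C X Y" "t \<in> Hom C X Y" "f = e \<boxplus> t"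
    using ideal_sumE[OF _ h] sub[OF b(1)] f by blast
  then have "t \<in> (\<Inter>a\<in>S. T a)" using b by blast
  then show "f \<in> ideal_sum C E (\<Inter>a\<in>S. T a)" using et ideal_sumI by metis
qed

lemma idempotent_subset_sum_transfinite_power:
  fixes a :: "'w::wellorder"
  assumes dcc: "local_dcc C" and I: "idempotent_ideal C I" and E: "cat_ideal C E"
    and J: "cat_ideal C J" and sub: "I \<subseteq> ideal_sum C E J"
  shows "I \<subseteq> ideal_sum C E (transfinite_power C J a)"
proof (induction a rule: less_induct)
  case (less a)
  note T = cat_ideal_transfinite_power[OF J]
  have IM: "I \<subseteq> Mor C" using I by (simp add: idempotent_ideal_def cat_ideal_def)
  consider "finite {..<a}" "card {..<a} = 0" | "finite {..<a}" "card {..<a} > 0"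
    | "infinite {..<a}" "limit_ordinal a" | "infinite {..<a}" "\<not> limit_ordinal a"
    by blast
  then show ?case
  proof cases
    case 1
    then have "transfinite_power C J a = Mor C"
      by (simp add: transfinite_power_finite ideal_power_def)
    then show ?thesis using IM right_subset_ideal_sum[OF E cat_ideal_Mor] by auto
  next
    case 2
    then show ?thesis
      using idempotent_subset_sum_power[OF I E J sub] by (simp add: transfinite_power_finite)
  next
    case 3
    then have "{..<a} \<noteq> {}" by auto
    then show ?thesis unfolding transfinite_power_limit[OF 3]
      by (intro subset_sum_Inter[OF dcc T transfinite_power_antimono[OF J] _ IM]) (auto dest: less)
  next
    case 4
    then obtain b where b: "b < a" "limit_ordinal b" "finite {b..<a}"
      using limit_part_ex1[OF 4] by blast
    show ?thesis unfolding transfinite_power_successor[OF 4 b]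
      by (rule idempotent_subset_sum_power[OF I E T less[OF b(1)]]) simp
  qed
qed

section \<open>Components of a morphism and the radical\<close>

text \<open>
  This encodes \<open>id\<^sub>S = \<Sum>\<^sub>k i\<^sub>k p\<^sub>k\<close>, with \<open>i\<^sub>k\<close> the injections and \<open>p\<^sub>k\<close> the projections, without
  finite sums: the induction produces the partial sums, which are determined by their restrictions along
  the injections.
\<close>

lemma coproduct_Ident_induct:
  assumes cop: "is_coproduct C n A S i"
    and zero: "P (Zero C S S)"
    and plus: "\<And>g h. g \<in> Hom C S S \<Longrightarrow> h \<in> Hom C S S \<Longrightarrow> P g \<Longrightarrow> P h \<Longrightarrow> P (g \<boxplus> h)"
    and comp: "\<And>k p. k < n \<Longrightarrow> p \<in> Hom C S (A k) \<Longrightarrow> P (i k \<cdot> p)"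
  shows "P (Ident C S)"
proof -
  have A: "\<And>k. k < n \<Longrightarrow> A k \<in> Obj C" and S: "S \<in> Obj C" and i: "\<And>k. k < n \<Longrightarrow> i k \<in> Hom C (A k) S"
    and univ: "\<And>Z g. Z \<in> Obj C \<Longrightarrow> (\<And>k. k < n \<Longrightarrow> g k \<in> Hom C (A k) Z) \<Longrightarrow>
        \<exists>!h. h \<in> Hom C S Z \<and> (\<forall>k<n. h \<cdot> i k = g k)"
    using cop unfolding is_coproduct_def by blast+
  have "\<exists>h\<in>Hom C S S. P h \<and> (\<forall>k<n. h \<cdot> i k = (if k < m then i k else Zero C (A k) S))" if "m \<le> n" for m
    using that
  proof (induction m)
    case 0
    show ?case
      using zero Zero_in_Hom[OF S S] Zero_Comp[OF i S] by (intro bexI[of _ "Zero C S S"]) auto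
  next
    case (Suc m)
    then have m: "m < n" by simp
    from Suc obtain h where h: "h \<in> Hom C S S" "P h"
      "\<And>k. k < n \<Longrightarrow> h \<cdot> i k = (if k < m then i k else Zero C (A k) S)" by auto
    have "\<exists>!p. p \<in> Hom C S (A m) \<and>
        (\<forall>k<n. p \<cdot> i k = (if k = m then Ident C (A m) else Zero C (A k) (A m)))"
      by (rule univ) (use A m Ident_in_Hom Zero_in_Hom in auto)
    then obtain p where p: "p \<in> Hom C S (A m)"
      "\<And>k. k < n \<Longrightarrow> p \<cdot> i k = (if k = m then Ident C (A m) else Zero C (A k) (A m))"
      by blast
    have ip: "i m \<cdot> p \<in> Hom C S S" using Comp_in_Hom[OF p(1) i[OF m]] .
    have "(h \<boxplus> i m \<cdot> p) \<cdot> i k = (if k < Suc m then i k else Zero C (A k) S)" if k: "k < n" for k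
    proof -
      have "(h \<boxplus> i m \<cdot> p) \<cdot> i k = h \<cdot> i k \<boxplus> i m \<cdot> (p \<cdot> i k)"
        using Comp_Plus_left[OF i[OF k] h(1) ip] Comp_assoc[OF i[OF k] p(1) i[OF m]] by simp
      also have "\<dots> = (if k < Suc m then i k else Zero C (A k) S)"
        using h(3)[OF k] p(2)[OF k] Comp_Ident[OF i[OF m]] Comp_Zero[OF i[OF m] A[OF k]]
          Zero_Plus[OF i[OF k]] Plus_Zero[OF i[OF k]] Plus_Zero[OF Zero_in_Hom[OF A[OF k] S]]
        by (cases "k = m") auto
      finally show ?thesis .
    qed
    then show ?case
      using plus[OF h(1) ip h(2) comp[OF m p(1)]] Plus_in_Hom[OF h(1) ip] by blast
  qed
  from this[of n] obtain h where h: "h \<in> Hom C S S" "P h" "\<forall>k<n. h \<cdot> i k = i k" by auto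
  have "h = Ident C S"
    using univ[of S i] S i h(1,3) Ident_in_Hom[OF S] Ident_Comp[OF i] by blast
  with h show ?thesis by simp
qed

text \<open>
  Writing \<open>f = id\<^sub>Y f id\<^sub>X\<close> and expanding both identities into injections and projections makes \<open>f\<close> a sum
  of morphisms \<open>j\<^sub>l (q\<^sub>l f i\<^sub>k) p\<^sub>k\<close>.
\<close>

lemma in_ideal_if_components:
  assumes K: "cat_ideal C K" and f: "f \<in> Hom C X Y"
    and X: "is_coproduct C m A X i" and Y: "is_coproduct C n B Y j"
    and comp: "\<And>k l q. k < m \<Longrightarrow> l < n \<Longrightarrow> q \<in> Hom C Y (B l) \<Longrightarrow> q \<cdot> f \<cdot> i k \<in> K"
  shows "f \<in> K"
proof -
  note obj = Hom_objects[OF preadditive_category_axioms f]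
  have i: "\<And>k. k < m \<Longrightarrow> i k \<in> Hom C (A k) X" and j: "\<And>l. l < n \<Longrightarrow> j l \<in> Hom C (B l) Y"
    using X Y unfolding is_coproduct_def by blast+
  have *: "q \<cdot> f \<in> K" if l: "l < n" and q: "q \<in> Hom C Y (B l)" for l q
  proof -
    have qf: "q \<cdot> f \<in> Hom C X (B l)" using Comp_in_Hom[OF f q] .
    note B = Hom_objects(2)[OF preadditive_category_axioms q]
    have "q \<cdot> f \<cdot> Ident C X \<in> K"
    proof (rule coproduct_Ident_induct[OF X])
      show "q \<cdot> f \<cdot> Zero C X X \<in> K"
        using Comp_Zero[OF qf] obj ideal_Zero[OF K] B by simp
      show "q \<cdot> f \<cdot> (g \<boxplus> h) \<in> K"
        if "g \<in> Hom C X X" "h \<in> Hom C X X" "q \<cdot> f \<cdot> g \<in> K" "q \<cdot> f \<cdot> h \<in> K" for g h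
        using that Comp_Plus_right[OF _ _ qf] ideal_Plus[OF K] Comp_in_Hom[OF _ qf] by metis
      show "q \<cdot> f \<cdot> (i k \<cdot> p) \<in> K" if "k < m" "p \<in> Hom C X (A k)" for k p
        using that comp[OF _ l q] Comp_assoc[OF _ i qf] Comp_in_Hom[OF i qf] ideal_Comp_right[OF K] by metis
    qed
    then show ?thesis using Comp_Ident[OF qf] by simp
  qed
  have "Ident C Y \<cdot> f \<in> K"
  proof (rule coproduct_Ident_induct[OF Y])
    show "Zero C Y Y \<cdot> f \<in> K"
      using Zero_Comp[OF f] obj ideal_Zero[OF K] by simp
    show "(g \<boxplus> h) \<cdot> f \<in> K"
      if "g \<in> Hom C Y Y" "h \<in> Hom C Y Y" "g \<cdot> f \<in> K" "h \<cdot> f \<in> K" for g h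
      using that Comp_Plus_left[OF f] ideal_Plus[OF K] Comp_in_Hom[OF f] by metis
    show "j l \<cdot> q \<cdot> f \<in> K" if "l < n" "q \<in> Hom C Y (B l)" for l q
      using that *[OF that] Comp_assoc[OF f _ j] Comp_in_Hom[OF f] j ideal_Comp_left[OF K] by metis
  qed
  then show ?thesis using Ident_Comp[OF f] by simp
qed

lemma cat_ideal_radical: "cat_ideal C (radical C)"
  unfolding radical_def by (rule cat_ideal_generated) (auto simp: Hom_def)

lemma cat_ideal_identities:
  "cat_ideal C (ideal_generated C {Ident C X |X. X \<in> Obj C \<and> Ident C X \<in> I})"
  by (rule cat_ideal_generated) (use Ident_in_Hom in \<open>auto simp: Hom_def\<close>)

end

lemma (in krull_schmidt_category) ideal_subset_identities_plus_radical:
  assumes I: "cat_ideal C I"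
  shows "I \<subseteq> ideal_sum C (ideal_generated C {Ident C X |X. X \<in> Obj C \<and> Ident C X \<in> I}) (radical C)"
    (is "I \<subseteq> ideal_sum C ?E ?R")
proof
  fix f assume fI: "f \<in> I"
  define X Y where "X = Dom C f" "Y = Cod C f"
  then have f: "f \<in> Hom C X Y" using fI cat_ideal_subset_Mor[OF I] by (simp add: Hom_def)
  note obj = Hom_objects[OF preadditive_category_axioms f]
  obtain m A i where A: "\<And>k. k < m \<Longrightarrow> indecomposable C (A k)" and X: "is_coproduct C m A X i"
    using decomposition[OF obj(1)] by blast
  obtain n B j where B: "\<And>k. k < n \<Longrightarrow> indecomposable C (B k)" and Y: "is_coproduct C n B Y j"
    using decomposition[OF obj(2)] by blast
  note E = cat_ideal_identities[of I]
  show "f \<in> ideal_sum C ?E ?R"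
  proof (rule in_ideal_if_components[OF cat_ideal_sum[OF E cat_ideal_radical] f X Y])
    fix k l q assume k: "k < m" and l: "l < n" and q: "q \<in> Hom C Y (B l)"
    define g where "g = q \<cdot> f \<cdot> i k"
    have i: "i k \<in> Hom C (A k) X" using X k unfolding is_coproduct_def by blast
    have qf: "q \<cdot> f \<in> Hom C X (B l)" using Comp_in_Hom[OF f q] .
    have g: "g \<in> Hom C (A k) (B l)" unfolding g_def using Comp_in_Hom[OF i qf] .
    have gI: "g \<in> I"
      unfolding g_def using ideal_Comp_right[OF I ideal_Comp_left[OF I fI f q] qf i] .
    show "q \<cdot> f \<cdot> i k \<in> ideal_sum C ?E ?R"
    proof (cases "invertible_morphism C g")
      case False
      then have "g \<in> ?R"
        using A[OF k] B[OF l] g subset_ideal_generated unfolding radical_def by fast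
      then show ?thesis
        using right_subset_ideal_sum[OF E cat_ideal_radical] g_def by blast
    next
      case True
      then obtain g' where g': "g' \<in> Hom C (B l) (A k)" "g' \<cdot> g = Ident C (A k)"
        using g unfolding invertible_morphism_def Hom_def by auto
      then have "Ident C (A k) \<in> I" using ideal_Comp_left[OF I gI g g'(1)] by simp
      then have "Ident C (A k) \<in> ?E"
        using Hom_objects(1)[OF preadditive_category_axioms g] subset_ideal_generated by fast
      then have "g \<cdot> Ident C (A k) \<in> ?E"
        using ideal_Comp_left[OF E _ Ident_in_Hom g] Hom_objects(1)[OF preadditive_category_axioms g] by blast
      then have "g \<in> ?E" using Comp_Ident[OF g] by simp
      then show ?thesis
        using left_subset_ideal_sum[OF E cat_ideal_radical] g_def by blast
    qed
  qed
qed

text \<open>An ideal is closed under negation because \<open>- f\<^sub>1 = (- id) f\<^sub>1\<close>.\<close>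

lemma (in preadditive_category) ideal_cancel_left:
  assumes I: "cat_ideal C I" and f1: "f1 \<in> Hom C X Y" "f1 \<in> I" and f2: "f2 \<in> Hom C X Y"
    and sum: "f1 \<boxplus> f2 \<in> I"
  shows "f2 \<in> I"
proof -
  note obj = Hom_objects[OF preadditive_category_axioms f2]
  obtain u where u: "u \<in> Hom C Y Y" "Ident C Y \<boxplus> u = Zero C Y Y"
    using Plus_inverse[OF Ident_in_Hom[OF obj(2)]] by blast
  have uf: "u \<cdot> f1 \<in> Hom C X Y" "u \<cdot> f1 \<in> I"
    using Comp_in_Hom[OF f1(1) u(1)] ideal_Comp_left[OF I f1(2,1) u(1)] by auto
  have "f1 \<boxplus> u \<cdot> f1 = Zero C X Y"
    using Comp_Plus_left[OF f1(1) Ident_in_Hom[OF obj(2)] u(1)] u(2) Ident_Comp[OF f1(1)]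
      Zero_Comp[OF f1(1) obj(2)] by simp
  then have "u \<cdot> f1 \<boxplus> (f1 \<boxplus> f2) = f2"
    using Plus_assoc[OF uf(1) f1(1) f2] Plus_commute[OF uf(1) f1(1)] Zero_Plus[OF f2] by simp
  then show ?thesis
    using ideal_Plus[OF I uf(2) sum uf(1) Plus_in_Hom[OF f1(1) f2]] by simp
qed

section \<open>Idempotent ideals and the transfinite radical\<close>

theorem theorem8:
  fixes C :: "('o, 'm) preadd_cat" and I :: "'m set" and f :: 'm
  assumes "krull_schmidt_category C"
    and "local_dcc C"
    and "idempotent_ideal C I"
    and "f \<in> I"
  shows "\<exists>f1 f2. f1 \<in> I \<and> f2 \<in> I \<and>
    f1 \<in> Hom C (Dom C f) (Cod C f) \<and> f2 \<in> Hom C (Dom C f) (Cod C f) \<and>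
    f = Plus C f1 f2 \<and>
    f1 \<in> ideal_generated C {Ident C X |X. X \<in> Obj C \<and> Ident C X \<in> I} \<and>
    f2 \<in> transfinite_radical C"
proof -
  interpret krull_schmidt_category C by fact
  let ?E = "ideal_generated C {Ident C X |X. X \<in> Obj C \<and> Ident C X \<in> I}"
  let ?T = "transfinite_power C (radical C) :: 'm set ordinal \<Rightarrow> 'm set"
  have I: "cat_ideal C I" using assms(3) by (simp add: idempotent_ideal_def)
  have E: "cat_ideal C ?E" by (rule cat_ideal_identities)
  have EI: "?E \<subseteq> I" by (rule ideal_generated_least[OF I]) blast
  have "I \<subseteq> ideal_sum C ?E (?T a)" for a
    by (rule idempotent_subset_sum_transfinite_power[OF assms(2,3) E cat_ideal_radical
          ideal_subset_identities_plus_radical[OF I]])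
  moreover have "I \<subseteq> Mor C" using I by (simp add: cat_ideal_def)
  ultimately have "I \<subseteq> ideal_sum C ?E (\<Inter>a\<in>UNIV. ?T a)"
    by (intro subset_sum_Inter[OF assms(2) cat_ideal_transfinite_power[OF cat_ideal_radical]
          transfinite_power_antimono[OF cat_ideal_radical]]) simp_all
  then have "f \<in> ideal_sum C ?E (transfinite_radical C)"
    using assms(4) unfolding transfinite_radical_def transfinite_intersection_def by auto
  moreover have "f \<in> Hom C (Dom C f) (Cod C f)"
    using cat_ideal_subset_Mor[OF I assms(4)] by (simp add: Hom_def)
  ultimately obtain f1 f2 where f12: "f1 \<in> ?E" "f2 \<in> transfinite_radical C"
    "f1 \<in> Hom C (Dom C f) (Cod C f)" "f2 \<in> Hom C (Dom C f) (Cod C f)" "f = Plus C f1 f2"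
    by (rule ideal_sumE)
  moreover have "f1 \<in> I" using f12(1) EI by blast
  moreover have "f2 \<in> I" using ideal_cancel_left[OF I f12(3) \<open>f1 \<in> I\<close> f12(4)] f12(5) assms(4) by simp
  ultimately show ?thesis by blast
qed

end
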